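(* Let $n\geq 2$ be an integer. Then the parameter set $t$-$(v,k,\lambda)$ with $t=3$, $v=(2n-1)(4n-1)+1$, $k=4n-1$, $\lambda=1$ is admissible, but there is no block design with these parameters.
   Context: A $t$-$(v,k,\lambda)$ (block) design is a set $D$ of $k$-element subsets (blocks) of a $v$-element set $V$ such that every $t$-element subset of $V$ is contained in exactly $\lambda$ blocks (blocks are not repeated). The parameter set $t$-$(v,k,\lambda)$ is admissible if $\lambda_i=\frac{\binom{v-i}{t-i}}{\binom{k-i}{t-i}}\lambda$ is an integer for all $i\in\{0,\ldots,t\}$. *)

theory Defs
  imports Complex_Main
begin

definition block_design ::
  "nat \<Rightarrow> nat \<Rightarrow> nat \<Rightarrow> nat \<Rightarrow> 'a set \<Rightarrow> 'a set set \<Rightarrow> bool" where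
  "block_design t v k l V D \<longleftrightarrow>
     finite V \<and> card V = v \<and>
     (\<forall>B\<in>D. B \<subseteq> V \<and> card B = k) \<and>
     (\<forall>T. T \<subseteq> V \<and> card T = t \<longrightarrow> card {B \<in> D. T \<subseteq> B} = l)"

(* Meant for t \<le> k \<le> v and i \<le> t, where no subtraction truncates
   and the denominator is nonzero. *)
definition design_lambda :: "nat \<Rightarrow> nat \<Rightarrow> nat \<Rightarrow> nat \<Rightarrow> nat \<Rightarrow> rat" where
  "design_lambda t v k l i =
     of_nat ((v - i) choose (t - i)) / of_nat ((k - i) choose (t - i)) * of_nat l"

definition admissible :: "nat \<Rightarrow> nat \<Rightarrow> nat \<Rightarrow> nat \<Rightarrow> bool" where
  "admissible t v k l \<longleftrightarrow> (\<forall>i\<in>{0..t}. design_lambda t v k l i \<in> \<int>)"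

end

theory Submission
  imports Defs
begin

text \<open>Let \<open>B\<close> be a block of a \<open>3\<close>-\<open>(v,k,1)\<close> design, \<open>x \<in> B\<close> and \<open>y \<notin> B\<close>. For
  \<open>z \<in> B - {x}\<close>, the blocks through \<open>x, y, z\<close> are pairwise distinct: a common block for \<open>z \<noteq> w\<close>
  shares \<open>x, z, w\<close> with \<open>B\<close>, so it equals \<open>B\<close>, although it contains \<open>y\<close>. Distinct blocks through
  \<open>x\<close> and \<open>y\<close> are disjoint elsewhere, which gives \<open>(k - 1) (k - 2) \<le> v - 2\<close>. For the
  parameters in question this reads \<open>4 n - 2 \<le> 2 n\<close>.\<close>

text \<open>The design condition counts blocks. The \<open>\<exists>!\<close> form separates its two
  uses: existence, to choose a block through three points, and uniqueness, to identify blocks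
  sharing three points.\<close>

lemma steiner_triple_block_ex1:
  assumes "block_design 3 v k 1 V D" "x \<in> V" "y \<in> V" "z \<in> V" "x \<noteq> y" "x \<noteq> z" "y \<noteq> z"
  shows "\<exists>!B. B \<in> D \<and> {x, y, z} \<subseteq> B"
proof -
  have "card {B \<in> D. {x, y, z} \<subseteq> B} = 1"
    using assms(1)[unfolded block_design_def, THEN conjunct2, THEN conjunct2, THEN conjunct2,
        rule_format, of "{x, y, z}"] assms(2-) by simp
  then obtain B where "{B \<in> D. {x, y, z} \<subseteq> B} = {B}"
    by (rule card_1_singletonE)
  then have "C \<in> D \<and> {x, y, z} \<subseteq> C \<longleftrightarrow> C = B" for C
    by (simp only: set_eq_iff mem_Collect_eq singleton_iff)
  then show ?thesis
    by (simp only: ex1_eq)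
qed

lemma steiner_three_design_bound:
  assumes D: "block_design 3 v k 1 V D" and "3 \<le> k" "k < v"
  shows "(k - 1) * (k - 2) \<le> v - 2"
proof -
  have blocks: "B \<subseteq> V" "card B = k" if "B \<in> D" for B
    using D that unfolding block_design_def by auto
  have fin: "finite V" and cardV: "card V = v"
    using D unfolding block_design_def by auto
  \<comment> \<open>Nothing yet says that \<open>D\<close> is nonempty: a block is obtained by
    covering some triple of points. The point \<open>a\<close> of that block plays the role of
    \<open>x\<close>.\<close>
  have "3 \<le> card V"
    using assms cardV by simp
  then obtain T where T: "T \<subseteq> V" "card T = 3"
    by (meson obtain_subset_with_card_n)
  then obtain a b c where "T = {a, b, c}" "a \<noteq> b" "a \<noteq> c" "b \<noteq> c"
    by (auto simp: card_3_iff)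
  with T steiner_triple_block_ex1[OF D, of a b c] obtain B where B: "B \<in> D" "a \<in> B"
    by auto
  have "B \<noteq> V"
    using blocks[OF B(1)] cardV \<open>k < v\<close> by auto
  then obtain y where y: "y \<in> V" "y \<notin> B"
    using blocks[OF B(1)] by auto
  have "a \<in> V" "a \<noteq> y"
    using B y blocks[OF B(1)] by auto
  define Z where "Z = B - {a}"
  have Z: "finite Z" "card Z = k - 1"
    using blocks[OF B(1)] B(2) fin finite_subset unfolding Z_def by auto
  have "\<forall>z\<in>Z. \<exists>C. C \<in> D \<and> {a, y, z} \<subseteq> C"
  proof
    fix z assume "z \<in> Z"
    then have "z \<in> V" "a \<noteq> z" "y \<noteq> z"
      using blocks[OF B(1)] y unfolding Z_def by auto
    then show "\<exists>C. C \<in> D \<and> {a, y, z} \<subseteq> C"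
      using steiner_triple_block_ex1[OF D \<open>a \<in> V\<close> \<open>y \<in> V\<close>] \<open>a \<noteq> y\<close> by blast
  qed
  then obtain C where C: "\<And>z. z \<in> Z \<Longrightarrow> C z \<in> D \<and> {a, y, z} \<subseteq> C z"
    by metis
  define R where "R z = C z - {a, y}" for z
  have R: "R z \<subseteq> V - {a, y}" "card (R z) = k - 2" if "z \<in> Z" for z
  proof -
    show "R z \<subseteq> V - {a, y}"
      using C[OF that] blocks(1) unfolding R_def by blast
    have "card (R z) = card (C z) - card {a, y}"
      using C[OF that] unfolding R_def by (intro card_Diff_subset) auto
    then show "card (R z) = k - 2"
      using C[OF that] blocks(2) \<open>a \<noteq> y\<close> by auto
  qed
  have disj: "R z \<inter> R w = {}" if zw: "z \<in> Z" "w \<in> Z" "z \<noteq> w" for z w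
  proof (rule ccontr)
    assume "R z \<inter> R w \<noteq> {}"
    then obtain u where u: "u \<in> C z" "u \<in> C w" "u \<noteq> a" "u \<noteq> y"
      unfolding R_def by auto
    then have "u \<in> V"
      using C zw blocks(1) by blast
    \<comment> \<open>Both blocks contain the triple \<open>{a, y, u}\<close>. The common block then
      contains \<open>a\<close>, \<open>z\<close>, \<open>w\<close>, a triple lying in
      \<open>B\<close>.\<close>
    then have "C z = C w"
      using steiner_triple_block_ex1[OF D \<open>a \<in> V\<close> \<open>y \<in> V\<close>, of u] u C[OF zw(1)] C[OF zw(2)] \<open>a \<noteq> y\<close>
      by auto
    moreover have "z \<in> V" "w \<in> V" "{a, z, w} \<subseteq> B" "a \<noteq> z" "a \<noteq> w"
      using zw B blocks[OF B(1)] unfolding Z_def by auto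
    ultimately have "C z = B"
      using steiner_triple_block_ex1[OF D \<open>a \<in> V\<close>, of z w] C[OF zw(1)] C[OF zw(2)] B(1) zw(3)
      by auto
    then show False
      using C[OF zw(1)] y by auto
  qed
  have "(k - 1) * (k - 2) = (\<Sum>z\<in>Z. card (R z))"
    using R(2) Z by simp
  also have "\<dots> = card (\<Union>z\<in>Z. R z)"
    using Z R(1) fin disj by (intro card_UN_disjoint[symmetric]) (auto intro: finite_subset)
  also have "\<dots> \<le> card (V - {a, y})"
    using R(1) fin by (intro card_mono) auto
  also have "\<dots> = v - 2"
    using \<open>a \<in> V\<close> \<open>y \<in> V\<close> \<open>a \<noteq> y\<close> cardV by (simp add: card_Diff_subset)
  finally show ?thesis .
qed

lemma admissible_of_binomial_dvd:
  assumes "\<And>i. i \<le> t \<Longrightarrow> ((k - i) choose (t - i)) dvd ((v - i) choose (t - i))"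
  shows "admissible t v k l"
  unfolding admissible_def
proof
  fix i assume "i \<in> {0..t}"
  then obtain c where c: "(v - i) choose (t - i) = ((k - i) choose (t - i)) * c"
    using assms[of i] by auto
  show "design_lambda t v k l i \<in> \<int>"
    unfolding design_lambda_def c
    \<comment> \<open>With a zero denominator, HOL division gives 0, still an integer; otherwise the
      value is \<open>c * l\<close>.\<close>
    by (cases "(k - i) choose (t - i) = 0") auto
qed

text \<open>For i = 0, 1, 2, 3 the binomial quotients are \<open>n * v\<close>,
  \<open>n * k\<close>, \<open>2 * n\<close> and 1.\<close>

lemma admissible_three_design_parameters:
  fixes n :: nat
  assumes "n \<ge> 1"
  shows "admissible 3 ((2 * n - 1) * (4 * n - 1) + 1) (4 * n - 1) 1"
proof (rule admissible_of_binomial_dvd)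
  obtain m where m: "n = Suc m"
    using assms by (cases n) auto
  define v where "v = (2 * n - 1) * (4 * n - 1) + 1"
  define k where "k = 4 * n - 1"
  have l2: "v - 2 = (k - 2) * (2 * n)"
    by (simp add: v_def k_def m algebra_simps)
  have "2 * ((v - 1) choose 2) = (v - 1) * (v - 2)"
    using times_binomial_minus1_eq[of 2 "v - 1"] by (simp add: numeral_2_eq_2)
  moreover have "2 * ((k - 1) choose 2) = (k - 1) * (k - 2)"
    using times_binomial_minus1_eq[of 2 "k - 1"] by (simp add: numeral_2_eq_2)
  \<comment> \<open>Since k - 1 = 2(2n - 1), v - 1 is k(k - 1)/2; the half is absorbed by the factor
    2n of v - 2.\<close>
  moreover have "(v - 1) * (v - 2) = (k - 1) * (k - 2) * (n * k)"
    by (simp add: v_def k_def m algebra_simps)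
  ultimately have "2 * ((v - 1) choose 2) = 2 * (((k - 1) choose 2) * (n * k))"
    by (simp only: mult.assoc[symmetric])
  then have l1: "(v - 1) choose 2 = ((k - 1) choose 2) * (n * k)"
    by simp
  have v3: "3 * (v choose 3) = v * ((v - 1) choose 2)" and k3: "3 * (k choose 3) = k * ((k - 1) choose 2)"
    using times_binomial_minus1_eq[of 3 v] times_binomial_minus1_eq[of 3 k] by simp_all
  \<comment> \<open>The factor \<open>k\<close> in the quotient \<open>n * k\<close> from
    \<open>l1\<close> is what turns \<open>(k - 1) choose 2\<close> into
    \<open>3 * (k choose 3)\<close>.\<close>
  have "3 * (v choose 3) = k * ((k - 1) choose 2) * (n * v)"
    unfolding v3 l1 by (rule trans[OF _ mult.commute]) (simp add: ac_simps)
  also have "\<dots> = 3 * ((k choose 3) * (n * v))"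
    unfolding k3[symmetric] by (rule mult.assoc)
  finally have "3 * (v choose 3) = 3 * ((k choose 3) * (n * v))" .
  then have l0: "v choose 3 = (k choose 3) * (n * v)"
    by simp
  fix i :: nat
  assume "i \<le> 3"
  then consider "i = 0" | "i = 1" | "i = 2" | "i = 3"
    by linarith
  then have "((k - i) choose (3 - i)) dvd ((v - i) choose (3 - i))"
    by cases (use l0 l1 l2 in auto)
  then show "((4 * n - 1 - i) choose (3 - i)) dvd
      (((2 * n - 1) * (4 * n - 1) + 1 - i) choose (3 - i))"
    by (simp only: v_def k_def)
qed

theorem theorem3p5:
  fixes n :: nat
  assumes "n \<ge> 2"
  shows "admissible 3 ((2 * n - 1) * (4 * n - 1) + 1) (4 * n - 1) 1 \<and>
    (\<nexists>(V :: 'a set) (D :: 'a set set).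
       block_design 3 ((2 * n - 1) * (4 * n - 1) + 1) (4 * n - 1) 1 V D)"
proof (intro conjI notI)
  show "admissible 3 ((2 * n - 1) * (4 * n - 1) + 1) (4 * n - 1) 1"
    using assms by (intro admissible_three_design_parameters) simp
next
  assume "\<exists>(V :: 'a set) (D :: 'a set set).
    block_design 3 ((2 * n - 1) * (4 * n - 1) + 1) (4 * n - 1) 1 V D"
  then obtain V :: "'a set" and D :: "'a set set" where
    D: "block_design 3 ((2 * n - 1) * (4 * n - 1) + 1) (4 * n - 1) 1 V D"
    by blast
  \<comment> \<open>Writing \<open>n\<close> as \<open>m + 2\<close> removes the truncated
    subtractions. The bound becomes (4n - 2)(4n - 3) \<le> 2n(4n - 3), which fails once n exceeds 1;
    at n = 1 it is an equality.\<close>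
  obtain m where m: "n = m + 2"
    using assms by (metis add.commute le_Suc_ex)
  show False
    using steiner_three_design_bound[OF D] by (simp add: m algebra_simps)
qed

end
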